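(* Consider the status-updating semi-Markov decision process described in the context with a reliable channel, $p_s=1$, and let $\pi^*$ be the optimal policy. For any $s\in\mathcal S^\dagger$, we have $\pi^*(s)\ne(0,0)$ when $\frac12L(\boldsymbol a_f)(L(\boldsymbol a_f)+1)\ge\omega C(\boldsymbol a_f)$.
   Context: Parameters: positive integers $T_u$ and $T_u'$ (sizes in packets of a status update before and after preprocessing; one packet is sent per minislot), positive reals $l$ (bits per packet), $v$ (CPU cycles per bit), $f$ (CPU frequency), $\tau$ (minislot length), $\kappa$, $P$, and a weighting factor $\omega>0$. Put $T_p=\lceil T_u l v/(f\tau)\rceil$, $C_p=\kappa\tau f^3$, $C_u=P\tau$. The packet success probability is $p_s=1$. Actions: $\mathcal A=\{(0,0),(0,1),(1,1)\}$ (idle; transmit directly; preprocess then transmit). Durations in minislots: $L((0,0))=1$, $L((0,1))=T_u$, $L((1,1))=T_p+T_u'$. Energies: $C((0,0))=0$, $C((0,1))=T_uC_u$, $C((1,1))=T_pC_p+T_u'C_u$. States: the age of information (AoI) $s\in\mathcal S=\{1,2,\dots,\hat\delta\}$, where the upper limit $\hat\delta$ is assumed finite but arbitrarily large. $\mathcal S^\dagger=\{\min\{T_u,T_p+T_u'\},\dots,\hat\delta\}$ (smaller states are non-recurrent). Transitions $p(\cdot\mid s,\boldsymbol a)$ (deterministic since $p_s=1$): under $(0,0)$ the next state is $\min(s+1,\hat\delta)$; under $\boldsymbol a\in\{(0,1),(1,1)\}$ it is $\min(L(\boldsymbol a),\hat\delta)$. Cost of a time step: $R(s,\boldsymbol a)=\frac12(2s+L(\boldsymbol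 a)-1)L(\boldsymbol a)+\omega C(\boldsymbol a)$. The objective is to minimize, over stationary deterministic policies (attention is restricted to unichain policies), the average cost $\limsup_{T\to\infty}\mathbb E[\sum_{t=1}^T R(s(t),\boldsymbol a(t))]/\mathbb E[\sum_{t=1}^T L(\boldsymbol a(t))]$. Equivalent discrete-time MDP: fix $\epsilon\in(0,\min_{\boldsymbol a}L(\boldsymbol a)]$, and set $\bar R(s,\boldsymbol a)=R(s,\boldsymbol a)/L(\boldsymbol a)$, $\bar p(s'\mid s,\boldsymbol a)=\frac{\epsilon}{L(\boldsymbol a)}p(s'\mid s,\boldsymbol a)$ for $s'\ne s$, and $\bar p(s\mid s,\boldsymbol a)=1-\frac{\epsilon}{L(\boldsymbol a)}+\frac{\epsilon}{L(\boldsymbol a)}p(s\mid s,\boldsymbol a)$. The optimal average cost $\theta$ and the value function $V$ satisfy $\theta+V(s)=\min_{\boldsymbol a\in\mathcal A}\{\bar R(s,\boldsymbol a)+\sum_{s'\in\mathcal S}\bar p(s'\mid s,\boldsymbol a)V(s')\}$ for all $s\in\mathcal S$, and the optimal policy is $\pi^*(s)=\arg\min_{\boldsymbol a\in\mathcal A}\{\bar R(s,\boldsymbol a)+\sum_{s'\in\mathcal S}\bar p(s'\mid s,\boldsymbol a)V(s')\}$. The action $\boldsymbol a_f$ is $(0,1)$ if $T_u\le T_p+T_u'$ and $(1,1)$ if $T_u\ge T_p+T_u'$ (either one in case of equality).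
   Formalization: Proved for all sufficiently large age limits; when only the non-strict inequality holds, the optimal policy is assumed to break ties against idling (with equality, idling can also be a minimizer); under strict inequality it holds for every arg-min policy. *)

theory Defs
  imports "HOL-Probability.Probability"
begin

record params =
  T_u :: nat           \<comment> \<open>packets of an update before preprocessing\<close>
  T_u' :: nat          \<comment> \<open>packets of an update after preprocessing\<close>
  pkt_bits :: real     \<comment> \<open>l: bits per packet\<close>
  cyc_per_bit :: real  \<comment> \<open>v: CPU cycles per bit\<close>
  cpu_freq :: real     \<comment> \<open>f\<close>
  slot_len :: real     \<comment> \<open>tau: minislot length\<close>
  kappa :: real
  tx_power :: real     \<comment> \<open>P\<close>
  omega :: real        \<comment> \<open>weighting factor\<close>

definition valid_params :: "params \<Rightarrow> bool" where
  "valid_params M \<longleftrightarrow> T_u M > 0 \<and> T_u' M > 0 \<and> pkt_bits M > 0 \<and> cyc_per_bit M > 0 \<and>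
     cpu_freq M > 0 \<and> slot_len M > 0 \<and> kappa M > 0 \<and> tx_power M > 0 \<and> omega M > 0"

definition T_p :: "params \<Rightarrow> nat" where
  "T_p M = nat \<lceil>real (T_u M) * pkt_bits M * cyc_per_bit M / (cpu_freq M * slot_len M)\<rceil>"

definition C_p :: "params \<Rightarrow> real" where
  "C_p M = kappa M * slot_len M * cpu_freq M ^ 3"

definition C_u :: "params \<Rightarrow> real" where
  "C_u M = tx_power M * slot_len M"

type_synonym action = "nat \<times> nat"

definition actions :: "action set" where
  "actions = {(0, 0), (0, 1), (1, 1)}"

definition dur :: "params \<Rightarrow> action \<Rightarrow> nat" where
  "dur M a = (if a = (0, 0) then 1 else if a = (0, 1) then T_u M else T_p M + T_u' M)"

definition energy :: "params \<Rightarrow> action \<Rightarrow> real" where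
  "energy M a = (if a = (0, 0) then 0 else if a = (0, 1) then real (T_u M) * C_u M
     else real (T_p M) * C_p M + real (T_u' M) * C_u M)"

definition states :: "nat \<Rightarrow> nat set" where
  "states \<delta> = {1..\<delta>}"

definition dagger_states :: "params \<Rightarrow> nat \<Rightarrow> nat set" where
  "dagger_states M \<delta> = {min (T_u M) (T_p M + T_u' M)..\<delta>}"

text \<open>Transition kernel of the decision process for packet success probability 1; \<open>\<delta>\<close> is the
  upper limit of the age.\<close>

definition kernel :: "params \<Rightarrow> nat \<Rightarrow> nat \<Rightarrow> action \<Rightarrow> nat pmf" where
  "kernel M \<delta> s a =
     (if a = (0, 0) then return_pmf (min (s + 1) \<delta>) else return_pmf (min (dur M a) \<delta>))"

definition step_cost :: "params \<Rightarrow> nat \<Rightarrow> action \<Rightarrow> real" where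
  "step_cost M s a =
     1 / 2 * (2 * real s + real (dur M a) - 1) * real (dur M a) + omega M * energy M a"

text \<open>The law of the state after \<open>t\<close> steps under a stationary deterministic policy.\<close>

primrec state_dist :: "params \<Rightarrow> nat \<Rightarrow> (nat \<Rightarrow> action) \<Rightarrow> nat \<Rightarrow> nat \<Rightarrow> nat pmf" where
  "state_dist M \<delta> pol s0 0 = return_pmf s0"
| "state_dist M \<delta> pol s0 (Suc t) =
     bind_pmf (state_dist M \<delta> pol s0 t) (\<lambda>s. kernel M \<delta> s (pol s))"

definition average_cost :: "params \<Rightarrow> nat \<Rightarrow> nat \<Rightarrow> (nat \<Rightarrow> action) \<Rightarrow> ereal" where
  "average_cost M \<delta> s0 pol = limsup (\<lambda>T. ereal (
     (\<Sum>t<T. measure_pmf.expectation (state_dist M \<delta> pol s0 t) (\<lambda>s. step_cost M s (pol s))) /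
     (\<Sum>t<T. measure_pmf.expectation (state_dist M \<delta> pol s0 t) (\<lambda>s. real (dur M (pol s))))))"

text \<open>A recurrent class is a nonempty set of states that is exactly the set of states reachable
  from each of its members; a policy is unichain if its chain has a single recurrent class.\<close>

definition step_rel :: "params \<Rightarrow> nat \<Rightarrow> (nat \<Rightarrow> action) \<Rightarrow> (nat \<times> nat) set" where
  "step_rel M \<delta> pol = {(s, s'). s \<in> states \<delta> \<and> s' \<in> set_pmf (kernel M \<delta> s (pol s))}"

definition recurrent_class :: "params \<Rightarrow> nat \<Rightarrow> (nat \<Rightarrow> action) \<Rightarrow> nat set \<Rightarrow> bool" where
  "recurrent_class M \<delta> pol C \<longleftrightarrow>
     C \<noteq> {} \<and> C \<subseteq> states \<delta> \<and> (\<forall>s\<in>C. (step_rel M \<delta> pol)\<^sup>* `` {s} = C)"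

definition unichain_policies :: "params \<Rightarrow> nat \<Rightarrow> (nat \<Rightarrow> action) set" where
  "unichain_policies M \<delta> = {pol \<in> states \<delta> \<rightarrow> actions. \<exists>!C. recurrent_class M \<delta> pol C}"

definition optimal_average_cost :: "params \<Rightarrow> nat \<Rightarrow> nat \<Rightarrow> ereal" where
  "optimal_average_cost M \<delta> s0 = (INF pol\<in>unichain_policies M \<delta>. average_cost M \<delta> s0 pol)"

definition cost_rate :: "params \<Rightarrow> nat \<Rightarrow> action \<Rightarrow> real" where
  "cost_rate M s a = step_cost M s a / real (dur M a)"

definition pbar :: "params \<Rightarrow> nat \<Rightarrow> real \<Rightarrow> nat \<Rightarrow> action \<Rightarrow> nat \<Rightarrow> real" where
  "pbar M \<delta> \<epsilon> s a s' =
     (if s' \<noteq> s then \<epsilon> / real (dur M a) * pmf (kernel M \<delta> s a) s'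
      else 1 - \<epsilon> / real (dur M a) + \<epsilon> / real (dur M a) * pmf (kernel M \<delta> s a) s)"

definition Q :: "params \<Rightarrow> nat \<Rightarrow> real \<Rightarrow> (nat \<Rightarrow> real) \<Rightarrow> nat \<Rightarrow> action \<Rightarrow> real" where
  "Q M \<delta> \<epsilon> V s a = cost_rate M s a + (\<Sum>s'\<in>states \<delta>. pbar M \<delta> \<epsilon> s a s' * V s')"

definition bellman :: "params \<Rightarrow> nat \<Rightarrow> real \<Rightarrow> real \<Rightarrow> (nat \<Rightarrow> real) \<Rightarrow> bool" where
  "bellman M \<delta> \<epsilon> \<theta> V \<longleftrightarrow> (\<forall>s\<in>states \<delta>. \<theta> + V s = (MIN a\<in>actions. Q M \<delta> \<epsilon> V s a))"

definition optimal_policy ::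
  "params \<Rightarrow> nat \<Rightarrow> real \<Rightarrow> (nat \<Rightarrow> real) \<Rightarrow> (nat \<Rightarrow> action) \<Rightarrow> bool" where
  "optimal_policy M \<delta> \<epsilon> V pol \<longleftrightarrow>
     (\<forall>s\<in>states \<delta>. is_arg_min (Q M \<delta> \<epsilon> V s) (\<lambda>a. a \<in> actions) (pol s))"

text \<open>The minimizing action need not be unique, so \<open>arg min\<close> alone does not determine a policy.
  The following convention resolves a tie between idling and another action against idling; ties
  between the two transmitting actions stay open.\<close>

definition idles_only_if_strict ::
  "params \<Rightarrow> nat \<Rightarrow> real \<Rightarrow> (nat \<Rightarrow> real) \<Rightarrow> (nat \<Rightarrow> action) \<Rightarrow> bool" where
  "idles_only_if_strict M \<delta> \<epsilon> V pol \<longleftrightarrow>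
     (\<forall>s\<in>states \<delta>. pol s = (0, 0) \<longrightarrow>
        (\<forall>a\<in>actions - {(0, 0)}. Q M \<delta> \<epsilon> V s (0, 0) < Q M \<delta> \<epsilon> V s a))"

text \<open>A predicate, since both transmitting actions qualify when their durations agree.\<close>

definition is_a_f :: "params \<Rightarrow> action \<Rightarrow> bool" where
  "is_a_f M a \<longleftrightarrow> a = (0, 1) \<and> T_u M \<le> T_p M + T_u' M \<or> a = (1, 1) \<and> T_u M \<ge> T_p M + T_u' M"

end

theory Submission
  imports Defs
begin

text \<open>With \<open>W = \<epsilon> V\<close>, the optimality equation reads
  \<open>W s = min\<^sub>a (R s a - \<theta> L a + W s\<^sub>a)\<close>, where \<open>s\<^sub>a\<close> is the successor of \<open>s\<close> under \<open>a\<close>.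
  Retransmitting \<open>a\<^sub>f\<close> from the state \<open>L a\<^sub>f\<close>, which it reproduces, bounds \<open>\<theta>\<close> by
  \<open>(3 L a\<^sub>f - 1) / 2 + \<omega> C a\<^sub>f / L a\<^sub>f\<close>, which is at most \<open>2 L a\<^sub>f\<close> under the hypothesis; hence
  idling is not optimal at a large age limit. If \<open>s \<ge> L a\<^sub>f\<close> is the largest state with idling
  optimal, then some transmission \<open>a\<close> is optimal in \<open>s + 1\<close>. As \<open>a\<close> leads to the same state from
  \<open>s\<close> and from \<open>s + 1\<close>, \<open>\<theta> - s = W (s + 1) - W s \<ge> L a\<close>, so \<open>\<theta> \<ge> s + L a \<ge> 2 L a\<^sub>f\<close>. In case of
  equality throughout, \<open>a\<close> ties with idling in \<open>s\<close>.\<close>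

definition next_state :: "params \<Rightarrow> nat \<Rightarrow> nat \<Rightarrow> action \<Rightarrow> nat" where
  "next_state M \<delta> s a = (if a = (0, 0) then min (s + 1) \<delta> else min (dur M a) \<delta>)"

lemma kernel_eq_return_pmf: "kernel M \<delta> s a = return_pmf (next_state M \<delta> s a)"
  by (simp add: kernel_def next_state_def)

lemma dur_pos: "valid_params M \<Longrightarrow> 0 < dur M a"
  by (simp add: valid_params_def dur_def)

lemma next_state_in_states:
  assumes "valid_params M" "s \<in> states \<delta>"
  shows "next_state M \<delta> s a \<in> states \<delta>"
  using assms dur_pos[of M a] by (auto simp: next_state_def states_def)

text \<open>The self-loop in \<open>pbar\<close> leaves weight
  \<open>1 - \<epsilon> / dur M a\<close> on \<open>V s\<close>, so only the increment to the
  successor is scaled. Multiplying by \<open>dur M a\<close> then recovers the semi-Markov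
  form.\<close>

lemma Q_eq:
  assumes "valid_params M" "s \<in> states \<delta>"
  shows "Q M \<delta> \<epsilon> V s a =
    V s + (step_cost M s a + \<epsilon> * V (next_state M \<delta> s a) - \<epsilon> * V s) / real (dur M a)"
proof -
  let ?n = "next_state M \<delta> s a" and ?c = "\<epsilon> / real (dur M a)"
  \<comment> \<open>Two separate point masses also cover the case \<open>?n = s\<close>, where they
    add up.\<close>
  have "(\<Sum>s'\<in>states \<delta>. pbar M \<delta> \<epsilon> s a s' * V s') =
    (\<Sum>s'\<in>states \<delta>. (if s' = s then (1 - ?c) * V s else 0) + (if s' = ?n then ?c * V ?n else 0))"
    by (intro sum.cong refl)
      (auto simp: pbar_def kernel_eq_return_pmf indicator_def algebra_simps)
  also have "\<dots> = (1 - ?c) * V s + ?c * V ?n"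
    using assms next_state_in_states[OF assms, of a]
    by (simp add: sum.distrib states_def)
  finally show ?thesis
    by (simp add: Q_def cost_rate_def algebra_simps diff_divide_distrib add_divide_distrib)
qed

lemma Q_ge_if_bellman:
  assumes "bellman M \<delta> \<epsilon> \<theta> V" "s \<in> states \<delta>" "a \<in> actions"
  shows "\<theta> + V s \<le> Q M \<delta> \<epsilon> V s a"
  using assms by (auto simp: bellman_def actions_def)

lemma Q_optimal_policy:
  assumes "bellman M \<delta> \<epsilon> \<theta> V" "optimal_policy M \<delta> \<epsilon> V pol" "s \<in> states \<delta>"
  shows "Q M \<delta> \<epsilon> V s (pol s) = \<theta> + V s"
proof -
  have "pol s \<in> actions" "\<forall>a\<in>actions. Q M \<delta> \<epsilon> V s (pol s) \<le> Q M \<delta> \<epsilon> V s a"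
    using assms(2,3) by (auto simp: optimal_policy_def is_arg_min_def not_less)
  then have "(MIN a\<in>actions. Q M \<delta> \<epsilon> V s a) = Q M \<delta> \<epsilon> V s (pol s)"
    by (intro Min_eqI) (auto simp: actions_def)
  then show ?thesis
    using assms(1,3) by (simp add: bellman_def)
qed

lemma bellman_ineq:
  assumes "valid_params M" "bellman M \<delta> \<epsilon> \<theta> V" "s \<in> states \<delta>" "a \<in> actions"
  shows "\<theta> * real (dur M a) \<le> step_cost M s a + \<epsilon> * V (next_state M \<delta> s a) - \<epsilon> * V s"
  using Q_ge_if_bellman[OF assms(2-4)] dur_pos[OF assms(1), of a]
  by (simp add: Q_eq[OF assms(1,3)] field_simps)

lemma Q_eq_iff:
  assumes "valid_params M" "s \<in> states \<delta>"
  shows "Q M \<delta> \<epsilon> V s a = \<theta> + V s \<longleftrightarrow>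
    \<theta> * real (dur M a) = step_cost M s a + \<epsilon> * V (next_state M \<delta> s a) - \<epsilon> * V s"
  using dur_pos[OF assms(1), of a] by (auto simp: Q_eq[OF assms] field_simps)

text \<open>The bound on \<open>dur M a\<close> keeps the age limit from truncating the successor,
  so the state \<open>dur M a\<close> is a fixed point and the value terms cancel.\<close>

lemma theta_le_repeat_transmit:
  assumes "valid_params M" "bellman M \<delta> \<epsilon> \<theta> V" "a \<in> actions" "a \<noteq> (0, 0)" "dur M a \<le> \<delta>"
  shows "\<theta> * real (dur M a) \<le> 1 / 2 * (3 * real (dur M a) - 1) * real (dur M a) + omega M * energy M a"
proof -
  have "dur M a \<in> states \<delta>"
    using assms(5) dur_pos[OF assms(1), of a] by (simp add: states_def)
  from bellman_ineq[OF assms(1,2) this assms(3)] show ?thesis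
    using assms(4,5) by (simp add: next_state_def step_cost_def)
qed

lemma idle_cost: "step_cost M s (0, 0) = real s"
  by (simp add: step_cost_def dur_def energy_def)

lemma step_cost_Suc: "step_cost M (Suc s) a = step_cost M s a + real (dur M a)"
  by (simp add: step_cost_def algebra_simps)

text \<open>Truncation makes \<open>\<delta>\<close> its own successor under idling, so the value
  terms cancel.\<close>

lemma theta_eq_if_idle_at_limit:
  assumes "valid_params M" "bellman M \<delta> \<epsilon> \<theta> V" "optimal_policy M \<delta> \<epsilon> V pol"
    and "0 < \<delta>" "pol \<delta> = (0, 0)"
  shows "\<theta> = real \<delta>"
proof -
  have s: "\<delta> \<in> states \<delta>"
    using assms(4) by (simp add: states_def)
  show ?thesis
    using Q_optimal_policy[OF assms(2,3) s] assms(5)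
    by (simp add: Q_eq_iff[OF assms(1) s] idle_cost next_state_def) (simp add: dur_def)
qed

lemma theta_ge_if_idle_then_transmit:
  assumes "valid_params M" "bellman M \<delta> \<epsilon> \<theta> V" "optimal_policy M \<delta> \<epsilon> V pol"
    and "0 < s" "Suc s \<le> \<delta>" "pol s = (0, 0)" "pol (Suc s) \<noteq> (0, 0)"
  defines "a \<equiv> pol (Suc s)"
  shows "real s + real (dur M a) \<le> \<theta>"
    and "\<theta> = real s + real (dur M a) \<Longrightarrow> Q M \<delta> \<epsilon> V s a = Q M \<delta> \<epsilon> V s (0, 0)"
proof -
  have s: "s \<in> states \<delta>" "Suc s \<in> states \<delta>"
    using assms(4,5) by (auto simp: states_def)
  have a: "a \<in> actions"
    using assms(3) s(2) by (simp add: optimal_policy_def is_arg_min_def a_def)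
  have same_successor: "next_state M \<delta> (Suc s) a = next_state M \<delta> s a"
    using assms(7) by (simp add: next_state_def a_def)
  have Q_idle: "Q M \<delta> \<epsilon> V s (0, 0) = \<theta> + V s"
    using Q_optimal_policy[OF assms(2,3) s(1)] assms(6) by simp
  then have idle: "\<theta> = real s + \<epsilon> * V (Suc s) - \<epsilon> * V s"
    using assms(5) by (simp add: Q_eq_iff[OF assms(1) s(1)] idle_cost next_state_def)
      (simp add: dur_def min_absorb1)
  have "\<theta> * real (dur M a) =
      step_cost M (Suc s) a + \<epsilon> * V (next_state M \<delta> (Suc s) a) - \<epsilon> * V (Suc s)"
    using Q_optimal_policy[OF assms(2,3) s(2)] by (simp add: Q_eq_iff[OF assms(1) s(2)] a_def)
  then have transmit: "\<theta> * real (dur M a) =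
      step_cost M s a + real (dur M a) + \<epsilon> * V (next_state M \<delta> s a) - \<epsilon> * V (Suc s)"
    by (simp add: step_cost_Suc same_successor)
  \<comment> \<open>Subtracting \<open>transmit\<close> from the inequality for \<open>a\<close> in
    \<open>s\<close> leaves \<open>dur M a \<le> \<epsilon> * V (Suc s) - \<epsilon> * V s\<close>,
    whose right side is \<open>\<theta> - s\<close> by \<open>idle\<close>.\<close>
  show "real s + real (dur M a) \<le> \<theta>"
    using bellman_ineq[OF assms(1,2) s(1) a] idle transmit by linarith
  show "Q M \<delta> \<epsilon> V s a = Q M \<delta> \<epsilon> V s (0, 0)" if "\<theta> = real s + real (dur M a)"
  proof -
    have "Q M \<delta> \<epsilon> V s a = \<theta> + V s"
      unfolding Q_eq_iff[OF assms(1) s(1)] using that idle transmit by linarith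
    then show ?thesis
      using Q_idle by simp
  qed
qed

lemma last_idle_state:
  fixes pol :: "nat \<Rightarrow> action"
  assumes "pol s = (0, 0)" "s \<le> \<delta>" "pol \<delta> \<noteq> (0, 0)"
  obtains t where "s \<le> t" "Suc t \<le> \<delta>" "pol t = (0, 0)" "pol (Suc t) \<noteq> (0, 0)"
proof -
  let ?P = "\<lambda>t. t \<le> \<delta> \<and> pol t = (0, 0)"
  define t where "t = (GREATEST t. ?P t)"
  have P: "?P t"
    unfolding t_def using assms by (intro GreatestI_nat[of ?P s \<delta>]) auto
  have le: "u \<le> t" if "?P u" for u
    unfolding t_def using that by (intro Greatest_le_nat[of ?P u \<delta>]) auto
  have "t \<noteq> \<delta>"
    using P assms(3) by auto
  moreover have "s \<le> t"
    using le assms by simp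
  moreover have "pol (Suc t) \<noteq> (0, 0)" if "Suc t \<le> \<delta>"
    using le[of "Suc t"] that by auto
  ultimately show thesis
    using that[of t] P by auto
qed

theorem lemma4:
  fixes M :: params and a_f :: action
  assumes "valid_params M"
    and "is_a_f M a_f"
  shows "\<exists>\<delta>\<^sub>0. \<forall>\<delta>\<ge>\<delta>\<^sub>0. \<forall>\<epsilon> \<theta> V s\<^sub>1 pol.
    0 < \<epsilon> \<and> \<epsilon> \<le> real (MIN a\<in>actions. dur M a) \<and>
    s\<^sub>1 \<in> states \<delta> \<and> ereal \<theta> = optimal_average_cost M \<delta> s\<^sub>1 \<and>
    bellman M \<delta> \<epsilon> \<theta> V \<and> optimal_policy M \<delta> \<epsilon> V pol \<longrightarrow>
    (\<forall>s\<in>dagger_states M \<delta>.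
      (1 / 2 * real (dur M a_f) * (real (dur M a_f) + 1) \<ge> omega M * energy M a_f \<and>
         idles_only_if_strict M \<delta> \<epsilon> V pol \<longrightarrow> pol s \<noteq> (0, 0)) \<and>
      (1 / 2 * real (dur M a_f) * (real (dur M a_f) + 1) > omega M * energy M a_f \<longrightarrow>
         pol s \<noteq> (0, 0)))"
proof -
  let ?L = "dur M a_f"
  have a_f: "a_f \<in> actions" "a_f \<noteq> (0, 0)"
    and L_min: "?L = min (T_u M) (T_p M + T_u' M)"
    using assms(2) by (auto simp: is_a_f_def actions_def dur_def)
  have L_pos: "0 < ?L"
    using dur_pos[OF assms(1)] .
  have L_le: "?L \<le> dur M a" if "a \<noteq> (0, 0)" for a
    using that unfolding L_min by (auto simp: dur_def)
  \<comment> \<open>Under the weak inequality, an idle state refutes both the strict inequality and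
    the tie-breaking convention, which settles both conjuncts of the goal.\<close>
  have main: "\<not> 1 / 2 * real ?L * (real ?L + 1) > omega M * energy M a_f \<and>
      \<not> idles_only_if_strict M \<delta> \<epsilon> V pol"
    if large: "2 * ?L + 1 \<le> \<delta>" and bell: "bellman M \<delta> \<epsilon> \<theta> V"
      and opt: "optimal_policy M \<delta> \<epsilon> V pol" and s: "s \<in> dagger_states M \<delta>"
      and weak: "1 / 2 * real ?L * (real ?L + 1) \<ge> omega M * energy M a_f"
      and idle: "pol s = (0, 0)"
    for \<delta> \<epsilon> \<theta> V pol s
  proof -
    have repeat: "\<theta> * real ?L \<le> 1 / 2 * (3 * real ?L - 1) * real ?L + omega M * energy M a_f"
      using theta_le_repeat_transmit[OF assms(1) bell a_f] large by simp
    also have "\<dots> \<le> 2 * real ?L * real ?L"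
      using weak by (simp add: field_simps)
    finally have \<theta>_le: "\<theta> \<le> 2 * real ?L"
      using L_pos by simp
    \<comment> \<open>Idling at the limit would give \<open>\<theta> = \<delta>\<close>, which
      exceeds \<open>2 * ?L\<close>.\<close>
    have "s \<le> \<delta>" "pol \<delta> \<noteq> (0, 0)"
      using s theta_eq_if_idle_at_limit[OF assms(1) bell opt] \<theta>_le large
      by (auto simp: dagger_states_def)
    then obtain t where t: "s \<le> t" "Suc t \<le> \<delta>" "pol t = (0, 0)" "pol (Suc t) \<noteq> (0, 0)"
      using last_idle_state[of pol s \<delta>] idle by blast
    let ?a = "pol (Suc t)"
    have L_le_t: "?L \<le> t"
      using s t(1) by (simp add: dagger_states_def L_min)
    then have t_pos: "0 < t"
      using L_pos by simp
    note transmit = theta_ge_if_idle_then_transmit[OF assms(1) bell opt t_pos t(2-4)]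
    \<comment> \<open>Both \<open>t\<close> and \<open>dur M ?a\<close> are at least
      \<open>?L\<close>, while their sum is at most \<open>2 * ?L\<close>.\<close>
    have \<theta>: "\<theta> = 2 * real ?L" "\<theta> = real t + real (dur M ?a)"
      using transmit(1) \<theta>_le L_le_t L_le[OF t(4)] by linarith+
    \<comment> \<open>With \<open>\<theta> = 2 * ?L\<close>, the bound \<open>repeat\<close> becomes
      the reverse of \<open>weak\<close>.\<close>
    have "\<not> 1 / 2 * real ?L * (real ?L + 1) > omega M * energy M a_f"
      using repeat by (simp add: \<theta>(1) field_simps)
    moreover have "\<not> idles_only_if_strict M \<delta> \<epsilon> V pol"
    proof
      assume tie_break: "idles_only_if_strict M \<delta> \<epsilon> V pol"
      have "t \<in> states \<delta>" "Suc t \<in> states \<delta>"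
        using t_pos t(2) by (auto simp: states_def)
      then have "?a \<in> actions - {(0, 0)}"
        using t(4) opt by (simp add: optimal_policy_def is_arg_min_def)
      then have "Q M \<delta> \<epsilon> V t (0, 0) < Q M \<delta> \<epsilon> V t ?a"
        using tie_break t(3) \<open>t \<in> states \<delta>\<close> unfolding idles_only_if_strict_def by blast
      then show False
        using transmit(2)[OF \<theta>(2)] by simp
    qed
    ultimately show ?thesis
      by blast
  qed
  show ?thesis
  \<comment> \<open>The witness is the least integer above the bound \<open>2 * ?L\<close> on
    \<open>\<theta>\<close>.\<close>
  proof (intro exI[of _ "2 * ?L + 1"] allI impI ballI conjI notI; elim conjE)
  qed (use main less_imp_le in blast)+
qed

end
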